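(* Let $F=(0,0)$ and let $\mathcal{F}=\{\mathcal{P}(p)\mid p\in\mathbb{R}\setminus\{0\}\}$ be the confocal family of parabolas $\mathcal{P}(p): y^2=2px+p^2$ with focus $F$. Let $E\in\mathbb{R}^2$ and let $\mathcal{D}(E)$ be the unit circle centered at $E$. Then $\mathcal{F}$ is $4$-isoperiodic with $\mathcal{D}(E)$ if and only if $E=F$.
   Context: Every parabola $\mathcal{P}(p)$ has focus $F=(0,0)$ and the $x$-axis as axis of symmetry. Real conics are identified with their complexifications in $\mathbb{CP}^2$, and polygons are taken in $\mathbb{CP}^2$ (vertices and sides may be non-real). For $n\ge 3$ and two smooth conics $\mathcal{C}_1,\mathcal{C}_2$, an $n$-Poncelet polygon is an $n$-gon ($n$ distinct vertices, $n$ distinct side lines) whose vertices lie on $\mathcal{C}_1$ and whose side lines are tangent to $\mathcal{C}_2$; a $k$-gon traversed $m>1$ times is not regarded as an $mk$-gon. The pair $(\mathcal{C}_1,\mathcal{C}_2)$ is an $n$-Poncelet pair if such an $n$-gon exists. A family $\mathcal{F}$ of nondegenerate conics is $n$-isoperiodic with a nondegenerate conic $\mathcal{D}$ if $(\mathcal{D},\mathcal{C})$ is an $n$-Poncelet pair for every nondegenerate conic $\mathcal{C}\in\mathcal{F}$. *)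

theory Defs
  imports "HOL-Analysis.Analysis"
begin

definition proportional :: "complex^3 \<Rightarrow> complex^3 \<Rightarrow> bool" where
  "proportional u v \<longleftrightarrow> u \<noteq> 0 \<and> v \<noteq> 0 \<and> (\<exists>c. c \<noteq> 0 \<and> v = c *s u)"

lemma part_equivp_proportional: "part_equivp proportional"
proof (rule part_equivpI)
  have "proportional 1 1"
    unfolding proportional_def by (metis one_neq_zero vector_smult_lid)
  then show "\<exists>x. proportional x x" by blast
  show "symp proportional"
  proof (rule sympI)
    fix u v assume "proportional u v"
    then obtain c where c: "u \<noteq> 0" "v \<noteq> 0" "c \<noteq> 0" "v = c *s u"
      unfolding proportional_def by blast
    then have "u = inverse c *s v" by (simp add: vector_smult_assoc)
    with c show "proportional v u"
      unfolding proportional_def by (metis nonzero_imp_inverse_nonzero)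
  qed
  show "transp proportional"
    unfolding proportional_def by (rule transpI) (metis mult_eq_0_iff vector_smult_assoc)
qed

text \<open>The complex projective plane. A point is the class of its homogeneous coordinates
  $(x, y, z)$; the affine point $(x, y)$ is the class of $(x, y, 1)$.\<close>

quotient_type cp2 = "complex^3" / partial: proportional
  by (rule part_equivp_proportional)

lift_definition affine_pt :: "complex \<Rightarrow> complex \<Rightarrow> cp2" is "\<lambda>x y. vector [x, y, 1]"
proof -
  fix x y :: complex
  have "(vector [x, y, 1] :: complex^3) \<noteq> 0"
    by (metis vector_3(3) zero_index one_neq_zero)
  then show "proportional (vector [x, y, 1]) (vector [x, y, 1])"
    unfolding proportional_def by (metis one_neq_zero vector_smult_lid)
qed

text \<open>The inner product of the library on \<^typ>\<open>complex^3\<close> is real-valued, so the complex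
  bilinear pairings below are written as sums.\<close>

lift_definition on_line :: "complex^3 \<Rightarrow> cp2 \<Rightarrow> bool" is
  "\<lambda>a u. (\<Sum>i\<in>UNIV. a $ i * u $ i) = 0"
  by (auto simp: proportional_def mult.left_commute simp flip: sum_distrib_left)

definition is_line :: "cp2 set \<Rightarrow> bool" where
  "is_line L \<longleftrightarrow> (\<exists>a. a \<noteq> 0 \<and> L = {P. on_line a P})"

text \<open>A conic is given by its matrix \<open>M\<close>, with equation $u^T M u = 0$. Polarity
  $u^T M v = 0$ yields both the locus (self-conjugate points) and the tangent lines.\<close>

lift_definition conjugate :: "complex^3^3 \<Rightarrow> cp2 \<Rightarrow> cp2 \<Rightarrow> bool" is
  "\<lambda>M u v. (\<Sum>i\<in>UNIV. \<Sum>j\<in>UNIV. u $ i * M $ i $ j * v $ j) = 0"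
proof -
  fix M :: "complex^3^3" and u u' v v'
  assume "proportional u u'" "proportional v v'"
  then obtain c d where cd: "c \<noteq> 0" "d \<noteq> 0" "u' = c *s u" "v' = d *s v"
    unfolding proportional_def by blast
  have "(\<Sum>i\<in>UNIV. \<Sum>j\<in>UNIV. u' $ i * M $ i $ j * v' $ j)
      = (c * d) * (\<Sum>i\<in>UNIV. \<Sum>j\<in>UNIV. u $ i * M $ i $ j * v $ j)"
    by (simp add: cd sum_distrib_left mult_ac)
  with cd show "((\<Sum>i\<in>UNIV. \<Sum>j\<in>UNIV. u $ i * M $ i $ j * v $ j) = 0)
      = ((\<Sum>i\<in>UNIV. \<Sum>j\<in>UNIV. u' $ i * M $ i $ j * v' $ j) = 0)"
    by simp
qed

definition smooth_conic :: "complex^3^3 \<Rightarrow> bool" where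
  "smooth_conic M \<longleftrightarrow> transpose M = M \<and> det M \<noteq> 0"

definition conic_points :: "complex^3^3 \<Rightarrow> cp2 set" where
  "conic_points M = {P. conjugate M P P}"

definition tangent_at :: "complex^3^3 \<Rightarrow> cp2 \<Rightarrow> cp2 set" where
  "tangent_at M P = {Q. conjugate M P Q}"

definition tangent_to :: "cp2 set \<Rightarrow> complex^3^3 \<Rightarrow> bool" where
  "tangent_to L M \<longleftrightarrow> (\<exists>P\<in>conic_points M. L = tangent_at M P)"

text \<open>An \<open>n\<close>-gon with vertices \<open>V 0, \<dots>, V (n - 1)\<close>, where the side \<open>S i\<close> joins \<open>V i\<close> to the next
  vertex cyclically. Distinctness excludes a \<open>k\<close>-gon traversed several times.\<close>

definition is_polygon :: "nat \<Rightarrow> (nat \<Rightarrow> cp2) \<Rightarrow> (nat \<Rightarrow> cp2 set) \<Rightarrow> bool" where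
  "is_polygon n V S \<longleftrightarrow> 3 \<le> n \<and> inj_on V {..<n} \<and> inj_on S {..<n} \<and>
     (\<forall>i<n. is_line (S i) \<and> V i \<in> S i \<and> V (Suc i mod n) \<in> S i)"

definition poncelet_polygon ::
    "nat \<Rightarrow> complex^3^3 \<Rightarrow> complex^3^3 \<Rightarrow> (nat \<Rightarrow> cp2) \<Rightarrow> (nat \<Rightarrow> cp2 set) \<Rightarrow> bool" where
  "poncelet_polygon n C1 C2 V S \<longleftrightarrow> is_polygon n V S \<and>
     (\<forall>i<n. V i \<in> conic_points C1) \<and> (\<forall>i<n. tangent_to (S i) C2)"

definition poncelet_pair :: "nat \<Rightarrow> complex^3^3 \<Rightarrow> complex^3^3 \<Rightarrow> bool" where
  "poncelet_pair n C1 C2 \<longleftrightarrow> smooth_conic C1 \<and> smooth_conic C2 \<and>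
     (\<exists>V S. poncelet_polygon n C1 C2 V S)"

definition isoperiodic :: "nat \<Rightarrow> (complex^3^3) set \<Rightarrow> complex^3^3 \<Rightarrow> bool" where
  "isoperiodic n \<F> D \<longleftrightarrow> (\<forall>C\<in>\<F>. smooth_conic C) \<and> smooth_conic D \<and>
     (\<forall>C\<in>\<F>. poncelet_pair n D C)"

text \<open>The complexification of the real conic
  $a x^2 + b x y + c y^2 + d x + e y + f = 0$.\<close>

definition complexified_conic ::
    "real \<Rightarrow> real \<Rightarrow> real \<Rightarrow> real \<Rightarrow> real \<Rightarrow> real \<Rightarrow> complex^3^3" where
  "complexified_conic a b c d e f = map_matrix complex_of_real
     (vector [vector [a, b / 2, d / 2],
              vector [b / 2, c, e / 2],
              vector [d / 2, e / 2, f]])"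

definition parabola :: "real \<Rightarrow> complex^3^3" where
  "parabola p = complexified_conic 0 0 1 (- 2 * p) 0 (- (p^2))"

definition unit_circle :: "real^2 \<Rightarrow> complex^3^3" where
  "unit_circle E = complexified_conic 1 0 1 (- 2 * E $ 1) (- 2 * E $ 2) ((E $ 1)^2 + (E $ 2)^2 - 1)"

lemma affine_pt_complexified_conic:
  "affine_pt x y \<in> conic_points (complexified_conic a b c d e f) \<longleftrightarrow>
     of_real a * x^2 + of_real b * x * y + of_real c * y^2
       + of_real d * x + of_real e * y + of_real f = 0"
  unfolding conic_points_def mem_Collect_eq complexified_conic_def
  by transfer (simp add: sum_3 map_matrix_def vector_3 power2_eq_square algebra_simps)

lemma affine_pt_parabola:
  "affine_pt x y \<in> conic_points (parabola p) \<longleftrightarrow> y^2 = 2 * of_real p * x + (of_real p)^2"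
  unfolding parabola_def affine_pt_complexified_conic by (auto simp: algebra_simps)

lemma affine_pt_unit_circle:
  "affine_pt (of_real (P $ 1)) (of_real (P $ 2)) \<in> conic_points (unit_circle E) \<longleftrightarrow> dist P E = 1"
proof -
  have "affine_pt (of_real (P $ 1)) (of_real (P $ 2)) \<in> conic_points (unit_circle E) \<longleftrightarrow>
      of_real ((P $ 1 - E $ 1)^2 + (P $ 2 - E $ 2)^2) = (of_real 1 :: complex)"
    unfolding unit_circle_def affine_pt_complexified_conic
    by (simp add: power2_eq_square algebra_simps)
  also have "\<dots> \<longleftrightarrow> dist P E = 1"
    unfolding of_real_eq_iff dist_vec_def L2_set_def by (simp add: sum_2 dist_real_def)
  finally show ?thesis .
qed

end

theory Submission imports Defs begin

text \<open>With \<open>\<epsilon> = e + i f\<close> for the centre $(e, f)$ and the circle parametrized rationally,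
  the chord joining \<open>t\<close> and \<open>s\<close> touches \<open>P(p)\<close> iff $A s^2 + B s + C = 0$, where
  $A = t (1 + \overline{\epsilon} t)$, $B = t^2 + 2 (e + p) t + 1$, $C = t + \epsilon$. In a Poncelet
  quadrilateral $t_0 t_1 t_2 t_3$ the quadratics belonging to $t_0$ and $t_2$ have the same
  distinct roots $t_1$ and $t_3$, so $(A : B : C)$ takes the same value at $t_0$ and $t_2$. If
  \<open>A, B, C\<close> are linearly independent, $(A : B : C)$ is a Veronese embedding and $t_0 = t_2$, a
  contradiction. Their determinant is, up to sign, $2 (|\epsilon|^2 (e + p) - e)$, which for
  $\epsilon \neq 0$ vanishes for at most one \<open>p\<close>. For $\epsilon = 0$ the quadrilaterals are
  $t, s, 1/t, 1/s$ with $t + 1/t + s + 1/s = -2p$.\<close>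

section \<open>Homogeneous representatives in the projective plane\<close>

lemma proportional_refl: "u \<noteq> 0 \<Longrightarrow> proportional u u"
  unfolding proportional_def by (metis one_neq_zero vector_smult_lid)

lemma cp2_cases:
  obtains u where "u \<noteq> 0" "P = abs_cp2 u"
proof (induction P rule: cp2.abs_induct)
  case (1 u)
  then show ?case by (auto simp: proportional_def)
qed

lemma abs_cp2_eqI: "proportional u v \<Longrightarrow> abs_cp2 u = abs_cp2 v"
  using Quotient3_rel_abs[OF Quotient3_cp2] .

lemma on_line_abs:
  "u \<noteq> 0 \<Longrightarrow> on_line a (abs_cp2 u) \<longleftrightarrow> a $ 1 * u $ 1 + a $ 2 * u $ 2 + a $ 3 * u $ 3 = 0"
  by (simp add: on_line.abs_eq proportional_refl sum_3)

lemma conjugate_abs: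
  "u \<noteq> 0 \<Longrightarrow> v \<noteq> 0 \<Longrightarrow> conjugate M (abs_cp2 u) (abs_cp2 v) \<longleftrightarrow>
    (\<Sum>i\<in>UNIV. \<Sum>j\<in>UNIV. u $ i * M $ i $ j * v $ j) = 0"
  by (simp add: conjugate.abs_eq proportional_refl)

lemma vec3_eq_0_iff: "(u :: complex^3) = 0 \<longleftrightarrow> u $ 1 = 0 \<and> u $ 2 = 0 \<and> u $ 3 = 0"
  by (simp add: vec_eq_iff forall_3)

section \<open>Smoothness of the two conics and the dual conic of the parabola\<close>

lemma smooth_conic_parabola: "p \<noteq> 0 \<Longrightarrow> smooth_conic (parabola p)"
  unfolding smooth_conic_def parabola_def complexified_conic_def
  by (simp add: transpose_def vec_eq_iff forall_3 map_matrix_def vector_3 det_3)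

lemma smooth_conic_unit_circle: "smooth_conic (unit_circle E)"
  unfolding smooth_conic_def unit_circle_def complexified_conic_def
  by (simp add: transpose_def vec_eq_iff forall_3 map_matrix_def vector_3 det_3
      power2_eq_square algebra_simps)

text \<open>Duality: the equation in \<open>a\<close> says that the line passes through its own
  pole, which is then the point of contact. It turns tangency into a quadratic condition on line
  coordinates.\<close>

lemma tangent_to_parabola_iff:
  assumes "p \<noteq> 0"
  shows "tangent_to L (parabola p) \<longleftrightarrow>
    (\<exists>a. a \<noteq> 0 \<and> L = {P. on_line a P} \<and>
      of_real p * ((a $ 1)^2 + (a $ 2)^2) = 2 * a $ 1 * a $ 3)"
proof
  assume "tangent_to L (parabola p)"
  then obtain P where P: "conjugate (parabola p) P P" "L = {Q. conjugate (parabola p) P Q}"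
    by (auto simp: tangent_to_def conic_points_def tangent_at_def)
  obtain u where u: "u \<noteq> 0" "P = abs_cp2 u" by (rule cp2_cases)
  \<comment> \<open>The polar of \<open>P\<close>: the matrix of the parabola applied to
    \<open>u\<close>.\<close>
  define a :: "complex^3" where
    "a = vector [- of_real p * u $ 3, u $ 2, - of_real p * u $ 1 - (of_real p)^2 * u $ 3]"
  have a: "a $ 1 = - of_real p * u $ 3" "a $ 2 = u $ 2"
    "a $ 3 = - of_real p * u $ 1 - (of_real p)^2 * u $ 3"
    by (simp_all add: a_def vector_3)
  have "a \<noteq> 0"
    using u(1) assms by (auto simp: vec3_eq_0_iff a)
  moreover have "conjugate (parabola p) P Q \<longleftrightarrow> on_line a Q" for Q
  proof -
    obtain v where v: "v \<noteq> 0" "Q = abs_cp2 v" by (rule cp2_cases)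
    show ?thesis
      using u v by (simp add: conjugate_abs on_line_abs a parabola_def complexified_conic_def
          map_matrix_def vector_3 sum_3 algebra_simps)
  qed
  moreover have "of_real p * ((a $ 1)^2 + (a $ 2)^2) = 2 * a $ 1 * a $ 3"
  proof -
    have "(u $ 2)^2 = 2 * of_real p * u $ 1 * u $ 3 + (of_real p)^2 * (u $ 3)^2"
      using P(1) u by (simp add: conjugate_abs parabola_def complexified_conic_def
          map_matrix_def vector_3 sum_3 power2_eq_square algebra_simps)
    then show ?thesis unfolding a by algebra
  qed
  ultimately show "\<exists>a. a \<noteq> 0 \<and> L = {P. on_line a P} \<and>
      of_real p * ((a $ 1)^2 + (a $ 2)^2) = 2 * a $ 1 * a $ 3"
    using P(2) by auto
next
  assume "\<exists>a. a \<noteq> 0 \<and> L = {P. on_line a P} \<and>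
      of_real p * ((a $ 1)^2 + (a $ 2)^2) = 2 * a $ 1 * a $ 3"
  then obtain a where a: "a \<noteq> 0" "L = {P. on_line a P}"
    and eq: "of_real p * ((a $ 1)^2 + (a $ 2)^2) = 2 * a $ 1 * a $ 3" by blast
  \<comment> \<open>The pole of the line: the inverse matrix of the parabola applied to
    \<open>a\<close>, times \<open>p\<close> to clear denominators.\<close>
  define u :: "complex^3" where
    "u = vector [of_real p * a $ 1 - a $ 3, of_real p * a $ 2, - a $ 1]"
  have u: "u $ 1 = of_real p * a $ 1 - a $ 3" "u $ 2 = of_real p * a $ 2" "u $ 3 = - a $ 1"
    by (simp_all add: u_def vector_3)
  have "u \<noteq> 0"
    using a(1) assms by (auto simp: vec3_eq_0_iff u)
  have "conjugate (parabola p) (abs_cp2 u) Q \<longleftrightarrow> on_line a Q" for Q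
  proof -
    obtain v where v: "v \<noteq> 0" "Q = abs_cp2 v" by (rule cp2_cases)
    have "conjugate (parabola p) (abs_cp2 u) Q \<longleftrightarrow>
        of_real p * (a $ 1 * v $ 1 + a $ 2 * v $ 2 + a $ 3 * v $ 3) = 0"
      using v \<open>u \<noteq> 0\<close> by (simp add: conjugate_abs u parabola_def complexified_conic_def
          map_matrix_def vector_3 sum_3 power2_eq_square algebra_simps)
    then show ?thesis using v assms by (simp add: on_line_abs)
  qed
  moreover have "on_line a (abs_cp2 u)"
    using eq \<open>u \<noteq> 0\<close> by (simp add: on_line_abs u power2_eq_square algebra_simps)
  ultimately show "tangent_to L (parabola p)"
    using a(2) by (auto simp: tangent_to_def conic_points_def tangent_at_def intro!: bexI[of _ "abs_cp2 u"])
qed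

section \<open>Rational parametrization of the complex circle\<close>

text \<open>In the coordinates $u = (x - e) + i (y - f)$, $v = (x - e) - i (y - f)$ the circle
  is $uv = 1$, parametrized by $(u : v : 1) = (t^2 : w^2 : tw)$; the two circular points are
  \<open>t = 0\<close> and \<open>w = 0\<close>.\<close>

definition circle_vec :: "real^2 \<Rightarrow> complex \<Rightarrow> complex \<Rightarrow> complex^3" where
  "circle_vec E t w = vector [(t^2 + w^2) / 2 + of_real (E $ 1) * t * w,
     - \<i> * (t^2 - w^2) / 2 + of_real (E $ 2) * t * w, t * w]"

lemma circle_vec_nth:
  "circle_vec E t w $ 1 = (t^2 + w^2) / 2 + of_real (E $ 1) * t * w"
  "circle_vec E t w $ 2 = - \<i> * (t^2 - w^2) / 2 + of_real (E $ 2) * t * w"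
  "circle_vec E t w $ 3 = t * w"
  by (simp_all add: circle_vec_def vector_3)

lemma circle_vec_eq_0_iff: "circle_vec E t w = 0 \<longleftrightarrow> t = 0 \<and> w = 0"
  by (auto simp: vec3_eq_0_iff circle_vec_nth)

definition circle_point :: "real^2 \<Rightarrow> complex \<Rightarrow> complex \<Rightarrow> cp2" where
  "circle_point E t w = abs_cp2 (circle_vec E t w)"

lemma circle_point_in_unit_circle:
  assumes "\<not> (t = 0 \<and> w = 0)"
  shows "circle_point E t w \<in> conic_points (unit_circle E)"
proof -
  define x y z where "x = circle_vec E t w $ 1" "y = circle_vec E t w $ 2" "z = circle_vec E t w $ 3"
  define e f :: complex where "e = of_real (E $ 1)" "f = of_real (E $ 2)"
  have "x = (t^2 + w^2) / 2 + e * t * w" "y = - \<i> * (t^2 - w^2) / 2 + f * t * w" "z = t * w"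
    by (simp_all add: x_y_z_def e_f_def circle_vec_nth)
  then have "2 * x = t^2 + w^2 + 2 * e * z" "2 * y = - \<i> * (t^2 - w^2) + 2 * f * z" "z = t * w"
    by (simp_all add: field_simps)
  moreover have "\<i>^2 = -1" by simp
  ultimately have "4 * (x^2 + y^2 - 2 * e * x * z - 2 * f * y * z + (e^2 + f^2 - 1) * z^2) = 0"
    by algebra
  then have "x^2 + y^2 - 2 * e * x * z - 2 * f * y * z + (e^2 + f^2 - 1) * z^2 = 0"
    by (simp only: mult_eq_0_iff) simp
  then show ?thesis
    using assms by (simp add: conic_points_def circle_point_def conjugate_abs circle_vec_eq_0_iff
        unit_circle_def complexified_conic_def map_matrix_def vector_3 sum_3 power2_eq_square
        x_y_z_def[symmetric] e_f_def[symmetric] algebra_simps)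
qed

lemma unit_circle_cases:
  assumes "P \<in> conic_points (unit_circle E)"
  obtains t w where "\<not> (t = 0 \<and> w = 0)" "P = circle_point E t w"
proof -
  obtain X where X: "X \<noteq> 0" "P = abs_cp2 X" by (rule cp2_cases)
  define x y z where "x = X $ 1" "y = X $ 2" "z = X $ 3"
  define e f :: complex where "e = of_real (E $ 1)" "f = of_real (E $ 2)"
  have eq: "x^2 + y^2 - 2 * e * x * z - 2 * f * y * z + (e^2 + f^2 - 1) * z^2 = 0"
    using assms X by (simp add: conic_points_def conjugate_abs
        unit_circle_def complexified_conic_def map_matrix_def vector_3 sum_3 power2_eq_square
        x_y_z_def[symmetric] e_f_def[symmetric] algebra_simps)
  define u v where "u = (x - e * z) + \<i> * (y - f * z)" "v = (x - e * z) - \<i> * (y - f * z)"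
  have "u * v = z^2"
  proof -
    have "\<i>^2 = -1" by simp
    with eq show ?thesis unfolding u_v_def by algebra
  qed
  then have "(csqrt u * csqrt v)^2 = z^2"
    by (simp add: power_mult_distrib)
  \<comment> \<open>The chosen square roots of \<open>u\<close> and \<open>v\<close> have product
    \<open>z\<close> or \<open>- z\<close>; negating one of them repairs the sign.\<close>
  then have "csqrt u * csqrt v = z \<or> csqrt u * - csqrt v = z"
    by (auto simp: power2_eq_iff)
  then obtain t w where tw: "t^2 = u" "w^2 = v" "t * w = z"
    by (metis power2_csqrt power2_minus)
  have "circle_vec E t w $ 1 = (t^2 + w^2) / 2 + e * (t * w)"
    "circle_vec E t w $ 2 = - \<i> * (t^2 - w^2) / 2 + f * (t * w)"
    "circle_vec E t w $ 3 = t * w"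
    by (simp_all add: circle_vec_nth e_f_def)
  moreover have "u + v = 2 * (x - e * z)" "u - v = 2 * \<i> * (y - f * z)"
    by (simp_all add: u_v_def)
  ultimately have "circle_vec E t w $ 1 = x" "circle_vec E t w $ 2 = y" "circle_vec E t w $ 3 = z"
    unfolding tw by (simp_all add: diff_divide_distrib)
  then have "X = circle_vec E t w"
    by (simp add: vec_eq_iff forall_3 x_y_z_def)
  with X that show thesis by (auto simp: circle_point_def circle_vec_eq_0_iff)
qed

section \<open>Chords of the circle\<close>

text \<open>In the coordinates u, v, z this is the line w r u + t s v - (t r + s w) z = 0: the cross
  product of (t^2, w^2, t w) and (s^2, r^2, s r) divided by s w - t r. Thanks to the division it
  remains meaningful for equal parameters, where it is the tangent of the circle.\<close>

definition chord :: "real^2 \<Rightarrow> complex \<Rightarrow> complex \<Rightarrow> complex \<Rightarrow> complex \<Rightarrow> complex^3" where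
  "chord E t w s r = vector [w * r + t * s, \<i> * (w * r - t * s),
     - (t * r + s * w) - of_real (E $ 1) * (w * r + t * s) - \<i> * of_real (E $ 2) * (w * r - t * s)]"

lemma chord_nth:
  "chord E t w s r $ 1 = w * r + t * s"
  "chord E t w s r $ 2 = \<i> * (w * r - t * s)"
  "chord E t w s r $ 3 = - (t * r + s * w)
     - of_real (E $ 1) * (w * r + t * s) - \<i> * of_real (E $ 2) * (w * r - t * s)"
  by (simp_all add: chord_def vector_3)

lemma on_line_circle_point:
  assumes "\<not> (t = 0 \<and> w = 0)"
  shows "on_line a (circle_point E t w) \<longleftrightarrow>
    (a $ 1 - \<i> * a $ 2) * t^2
      + 2 * (a $ 1 * of_real (E $ 1) + a $ 2 * of_real (E $ 2) + a $ 3) * (t * w)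
      + (a $ 1 + \<i> * a $ 2) * w^2 = 0" (is "_ \<longleftrightarrow> ?q = 0")
proof -
  have "?q = 2 * (a $ 1 * circle_vec E t w $ 1 + a $ 2 * circle_vec E t w $ 2
      + a $ 3 * circle_vec E t w $ 3)"
    unfolding circle_vec_nth by (simp add: field_simps)
  then have "?q = 0 \<longleftrightarrow> a $ 1 * circle_vec E t w $ 1 + a $ 2 * circle_vec E t w $ 2
      + a $ 3 * circle_vec E t w $ 3 = 0"
    by (simp only: mult_eq_0_iff) simp
  then show ?thesis
    using assms by (simp add: circle_point_def on_line_abs circle_vec_eq_0_iff)
qed

lemma on_line_chord:
  assumes "\<not> (x = 0 \<and> y = 0)"
  shows "on_line (chord E t w s r) (circle_point E x y) \<longleftrightarrow>
    (w * x - t * y) * (r * x - s * y) = 0"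
proof -
  define a where "a = chord E t w s r"
  define e f :: complex where "e = of_real (E $ 1)" "f = of_real (E $ 2)"
  have "a $ 1 = w * r + t * s" "a $ 2 = \<i> * (w * r - t * s)"
    "a $ 3 = - (t * r + s * w) - e * (w * r + t * s) - \<i> * f * (w * r - t * s)"
    by (simp_all add: a_def chord_nth e_f_def)
  moreover have "\<i>^2 = -1" by simp
  ultimately have "(a $ 1 - \<i> * a $ 2) * x^2 + 2 * (a $ 1 * e + a $ 2 * f + a $ 3) * (x * y)
      + (a $ 1 + \<i> * a $ 2) * y^2 = 2 * ((w * x - t * y) * (r * x - s * y))"
    by algebra
  then show ?thesis
    unfolding on_line_circle_point[OF assms] a_def e_f_def by simp
qed

text \<open>Injectivity of the parametrization on the projective line: the tangent
  \<open>chord E t w t w\<close> restricts to the square of a linear form, so it meets the circle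
  only at parameter (t : w). Conversely, scaling the parameters by \<open>c\<close> scales the
  vector by c^2.\<close>

lemma circle_point_eq_iff:
  assumes "\<not> (t = 0 \<and> w = 0)" "\<not> (s = 0 \<and> r = 0)"
  shows "circle_point E t w = circle_point E s r \<longleftrightarrow> t * r = s * w"
proof
  assume "circle_point E t w = circle_point E s r"
  moreover have "on_line (chord E t w t w) (circle_point E t w)"
    using assms by (simp add: on_line_chord)
  ultimately show "t * r = s * w"
    using assms by (simp add: on_line_chord mult.commute)
next
  assume eq: "t * r = s * w"
  obtain c where c: "s = c * t" "r = c * w"
  proof (cases "t = 0")
    case True
    with eq assms show ?thesis by (intro that[of "r / w"]) auto
  next
    case False
    with eq show ?thesis by (intro that[of "s / t"]) (auto simp: field_simps)
  qed
  have "circle_vec E s r = c^2 *s circle_vec E t w"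
    by (simp add: vec_eq_iff forall_3 circle_vec_nth c power2_eq_square algebra_simps
        add_divide_distrib diff_divide_distrib)
  then have "proportional (circle_vec E t w) (circle_vec E s r)"
    using assms c unfolding proportional_def
    by (auto simp: circle_vec_eq_0_iff intro!: exI[of _ "c^2"])
  then show "circle_point E t w = circle_point E s r"
    unfolding circle_point_def by (rule abs_cp2_eqI)
qed

text \<open>A binary quadratic form with two distinct projective zeros is a multiple of (w X - t Y)
  (r X - s Y). The homogeneous version also covers zeros at infinity.\<close>

lemma binary_quadratic_two_zeros:
  fixes A B C :: "'a::field"
  assumes "A * t^2 + B * (t * w) + C * w^2 = 0" "A * s^2 + B * (s * r) + C * r^2 = 0"
    and D: "t * r \<noteq> s * w"
  obtains k where "A = k * (w * r)" "B = - k * (t * r + s * w)" "C = k * (t * s)"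
proof -
  \<comment> \<open>Up to the nonzero factor, these are the 2 x 2 minors that make (A, B, C)
    parallel to (w r, - (t r + s w), t s).\<close>
  have "(t * r - s * w) * (A * (t * s) - C * (w * r)) = 0"
    "(t * r - s * w) * (A * (t * r + s * w) + B * (w * r)) = 0"
    "(t * r - s * w) * (B * (t * s) + C * (t * r + s * w)) = 0"
    using assms(1,2) by algebra+
  with D have h: "A * (t * s) = C * (w * r)" "B * (w * r) = - A * (t * r + s * w)"
    "B * (t * s) = - C * (t * r + s * w)"
    by (auto simp: add_eq_0_iff2)
  \<comment> \<open>\<open>k\<close> is read off from a nonzero coefficient of the product. If both
    outer ones vanish, the zeros are 0 and infinity and only the middle one is left.\<close>
  consider "w * r \<noteq> 0" | "t * s \<noteq> 0" | "w = 0" "s = 0" | "r = 0" "t = 0"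
    using D by (metis mult.commute mult_eq_0_iff)
  then show thesis
  proof cases
    case 1
    with h show ?thesis by (intro that[of "A / (w * r)"]) (auto simp: field_simps)
  next
    case 2
    with h show ?thesis by (intro that[of "C / (t * s)"]) (auto simp: field_simps)
  next
    case 3
    with h D assms show ?thesis by (intro that[of "- B / (t * r)"]) (auto simp: field_simps)
  next
    case 4
    with h D assms show ?thesis by (intro that[of "- B / (s * w)"]) (auto simp: field_simps)
  qed
qed

section \<open>Tangency of a chord to the parabola\<close>

text \<open>Half the value on the chord of the dual quadratic form of \<open>parabola p\<close>; the coefficients
  of $s^2$, $s r$, $r^2$ are \<open>A, B, C\<close> in homogeneous form.\<close>

definition tangency :: "real^2 \<Rightarrow> real \<Rightarrow> complex \<Rightarrow> complex \<Rightarrow> complex \<Rightarrow> complex \<Rightarrow> complex" where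
  "tangency E p t w s r =
     (t * (w + Complex (E $ 1) (- (E $ 2)) * t)) * s^2
     + (t^2 + of_real (2 * (E $ 1 + p)) * (t * w) + w^2) * (s * r)
     + (w * (t + Complex (E $ 1) (E $ 2) * w)) * r^2"

lemma tangency_chord:
  "of_real p * ((chord E t w s r $ 1)^2 + (chord E t w s r $ 2)^2)
     - 2 * chord E t w s r $ 1 * chord E t w s r $ 3 = 2 * tangency E p t w s r"
proof -
  have i: "\<i> * \<i> = -1" by simp
  have c: "Complex (E $ 1) (- (E $ 2)) = of_real (E $ 1) - \<i> * of_real (E $ 2)"
    "Complex (E $ 1) (E $ 2) = of_real (E $ 1) + \<i> * of_real (E $ 2)"
    "of_real (2 * (E $ 1 + p)) = 2 * (complex_of_real (E $ 1) + of_real p)"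
    by (simp_all add: complex_eq_iff)
  show ?thesis
    unfolding tangency_def chord_nth c power2_eq_square using i by algebra
qed

lemma chord_nonzero:
  assumes "t * r \<noteq> s * w"
  shows "chord E t w s r \<noteq> 0"
proof
  assume "chord E t w s r = 0"
  then have "w * r + t * s = 0" "w * r - t * s = 0" "t * r + s * w = 0"
    by (auto simp: vec3_eq_0_iff chord_nth)
  then have "w * r = 0" "t * s = 0" "t * r + s * w = 0" by auto
  with assms show False by auto
qed

text \<open>Pulled back along the parametrization, the line becomes a binary quadratic form
  vanishing at both parameters, hence a multiple of the form of the chord; its three coefficients
  determine \<open>a\<close>.\<close>

lemma line_through_circle_points:
  assumes "\<not> (t = 0 \<and> w = 0)" "\<not> (s = 0 \<and> r = 0)" "t * r \<noteq> s * w"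
    and "on_line a (circle_point E t w)" "on_line a (circle_point E s r)"
  obtains k where "a = k *s chord E t w s r"
proof -
  obtain k where k: "a $ 1 - \<i> * a $ 2 = k * (w * r)"
    "2 * (a $ 1 * of_real (E $ 1) + a $ 2 * of_real (E $ 2) + a $ 3) = - k * (t * r + s * w)"
    "a $ 1 + \<i> * a $ 2 = k * (t * s)"
    using binary_quadratic_two_zeros[OF assms(4)[unfolded on_line_circle_point[OF assms(1)]]
        assms(5)[unfolded on_line_circle_point[OF assms(2)]] assms(3)] by blast
  have i: "\<i>^2 = -1" by simp
  have "2 * a $ 1 = k * (w * r + t * s)" using k by algebra
  then have 1: "a $ 1 = k / 2 * (w * r + t * s)" by (simp add: field_simps)
  have "2 * a $ 2 = k * (\<i> * (w * r - t * s))" using k i by algebra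
  then have 2: "a $ 2 = k / 2 * (\<i> * (w * r - t * s))" by (simp add: field_simps)
  have "a $ 3 = - (k / 2) * (t * r + s * w) - a $ 1 * of_real (E $ 1) - a $ 2 * of_real (E $ 2)"
    using k(2) by (simp add: field_simps)
  then have "a $ 3 = k / 2 * (chord E t w s r $ 3)"
    unfolding 1 2 chord_nth by (simp add: algebra_simps)
  with 1 2 have "a = (k / 2) *s chord E t w s r"
    by (simp add: vec_eq_iff forall_3 chord_nth)
  then show thesis by (rule that)
qed

lemma tangency_if_tangent:
  assumes "p \<noteq> 0" "\<not> (t = 0 \<and> w = 0)" "\<not> (s = 0 \<and> r = 0)"
    and ne: "circle_point E t w \<noteq> circle_point E s r"
    and tan: "tangent_to L (parabola p)" "circle_point E t w \<in> L" "circle_point E s r \<in> L"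
  shows "tangency E p t w s r = 0"
proof -
  obtain a where a: "a \<noteq> 0" "L = {P. on_line a P}"
    "of_real p * ((a $ 1)^2 + (a $ 2)^2) = 2 * a $ 1 * a $ 3"
    using tan(1) unfolding tangent_to_parabola_iff[OF assms(1)] by blast
  obtain k where k: "a = k *s chord E t w s r"
    using line_through_circle_points[OF assms(2,3)] ne tan(2,3) a(2)
    by (auto simp: circle_point_eq_iff[OF assms(2,3)])
  have "k^2 * (2 * tangency E p t w s r) = 0"
    using a(3) unfolding tangency_chord[symmetric] k vector_smult_component by algebra
  with a(1) k show ?thesis by auto
qed

section \<open>Centre different from the focus: no quadrilateral for general
  \<open>p\<close>\<close>

text \<open>The left-hand sides are \<open>A\<close>, \<open>B\<close>, \<open>C\<close> with t^2, t
  w, w^2 replaced by free variables. Eliminating \<open>x\<close> and \<open>z\<close> multiplies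
  \<open>y\<close> by the determinant; once \<open>y\<close> = 0, the outer equations give the rest
  because the centre is not 0.\<close>

lemma veronese_coefficients_independent:
  fixes x y z :: complex
  assumes "E \<noteq> (0::real^2)" "((E $ 1)^2 + (E $ 2)^2) * (E $ 1 + p) \<noteq> E $ 1"
    and "y + Complex (E $ 1) (- (E $ 2)) * x = 0"
    and "x + of_real (2 * (E $ 1 + p)) * y + z = 0"
    and "y + Complex (E $ 1) (E $ 2) * z = 0"
  shows "x = 0 \<and> y = 0 \<and> z = 0"
proof -
  define \<epsilon> where "\<epsilon> = Complex (E $ 1) (E $ 2)"
  define \<delta> where "\<delta> = Complex (E $ 1) (- (E $ 2))"
  define \<sigma> :: complex where "\<sigma> = of_real (2 * (E $ 1 + p))"
  have "(\<epsilon> * \<delta> * \<sigma> - \<epsilon> - \<delta>) * y = 0"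
    using assms(3-5) unfolding \<epsilon>_def[symmetric] \<delta>_def[symmetric] \<sigma>_def[symmetric] by algebra
  moreover have "\<epsilon> * \<delta> * \<sigma> - \<epsilon> - \<delta>
      = of_real (2 * (((E $ 1)^2 + (E $ 2)^2) * (E $ 1 + p) - E $ 1))"
    by (simp add: complex_eq_iff \<epsilon>_def \<delta>_def \<sigma>_def power2_eq_square algebra_simps)
  then have "\<epsilon> * \<delta> * \<sigma> - \<epsilon> - \<delta> \<noteq> 0"
    using assms(2) by (simp only: of_real_eq_0_iff) simp
  ultimately have y: "y = 0" by simp
  have "E $ 1 \<noteq> 0 \<or> E $ 2 \<noteq> 0"
    using assms(1) by (auto simp: vec_eq_iff forall_2)
  then have "\<epsilon> \<noteq> 0" "\<delta> \<noteq> 0"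
    by (auto simp: \<epsilon>_def \<delta>_def complex_eq_iff)
  with y assms(3,5) show ?thesis
    by (simp add: \<epsilon>_def[symmetric] \<delta>_def[symmetric])
qed

lemma not_poncelet_pair_4:
  assumes E: "E \<noteq> 0" and p: "p \<noteq> 0"
    and indep: "((E $ 1)^2 + (E $ 2)^2) * (E $ 1 + p) \<noteq> E $ 1"
  shows "\<not> poncelet_pair 4 (unit_circle E) (parabola p)"
proof
  assume "poncelet_pair 4 (unit_circle E) (parabola p)"
  then obtain V S where VS: "inj_on V {..<4::nat}"
    "\<forall>i<4. V i \<in> S i \<and> V (Suc i mod 4) \<in> S i"
    "\<forall>i<4. V i \<in> conic_points (unit_circle E)" "\<forall>i<4. tangent_to (S i) (parabola p)"
    unfolding poncelet_pair_def poncelet_polygon_def is_polygon_def by auto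
  have "\<forall>i<4. \<exists>t w. \<not> (t = 0 \<and> w = 0) \<and> V i = circle_point E t w"
    using VS(3) by (metis unit_circle_cases)
  then obtain t w where tw: "\<And>i. i < 4 \<Longrightarrow> \<not> (t i = 0 \<and> w i = 0)"
    "\<And>i. i < 4 \<Longrightarrow> V i = circle_point E (t i) (w i)" by metis
  have cross: "t i * w j \<noteq> t j * w i" if "i < 4" "j < 4" "i \<noteq> j" for i j
    using that VS(1) tw circle_point_eq_iff[OF tw(1) tw(1)] by (auto simp: inj_on_def)
  have tangent: "tangency E p (t i) (w i) (t j) (w j) = 0"
    if "i < 4" "j < 4" "i \<noteq> j" "k < 4" "V i \<in> S k" "V j \<in> S k" for i j k
  proof (rule tangency_if_tangent[OF p])
    show "circle_point E (t i) (w i) \<noteq> circle_point E (t j) (w j)"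
      using that VS(1) tw(2) by (metis inj_on_eq_iff lessThan_iff)
  qed (use that tw VS(4) in auto)
  have mem: "V 0 \<in> S 0" "V 1 \<in> S 0" "V 1 \<in> S 1" "V 2 \<in> S 1" "V 2 \<in> S 2" "V 3 \<in> S 2"
    "V 3 \<in> S 3" "V 0 \<in> S 3"
    using VS(2)[rule_format, of 0] VS(2)[rule_format, of 1] VS(2)[rule_format, of 2]
      VS(2)[rule_format, of 3] by (simp_all flip: numeral_2_eq_2)
  \<comment> \<open>The sides are oriented so that the opposite vertices 0 and 2 supply the two
    quadratics, while 1 and 3 are their common roots.\<close>
  have T: "tangency E p (t 0) (w 0) (t 1) (w 1) = 0" "tangency E p (t 0) (w 0) (t 3) (w 3) = 0"
    "tangency E p (t 2) (w 2) (t 1) (w 1) = 0" "tangency E p (t 2) (w 2) (t 3) (w 3) = 0"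
    using tangent[of 0 1 0] tangent[of 0 3 3] tangent[of 2 1 1] tangent[of 2 3 2] mem by simp_all
  define \<epsilon> where "\<epsilon> = Complex (E $ 1) (E $ 2)"
  define \<delta> where "\<delta> = Complex (E $ 1) (- (E $ 2))"
  define \<sigma> :: complex where "\<sigma> = of_real (2 * (E $ 1 + p))"
  note defs = \<epsilon>_def[symmetric] \<delta>_def[symmetric] \<sigma>_def[symmetric]
  note T = T[unfolded tangency_def defs]
  note indep = veronese_coefficients_independent[OF E indep, unfolded defs]
  have c13: "t 1 * w 3 \<noteq> t 3 * w 1" by (rule cross) auto
  obtain k where k: "t 0 * (w 0 + \<delta> * t 0) = k * (w 1 * w 3)"
    "(t 0)^2 + \<sigma> * (t 0 * w 0) + (w 0)^2 = - k * (t 1 * w 3 + t 3 * w 1)"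
    "w 0 * (t 0 + \<epsilon> * w 0) = k * (t 1 * t 3)"
    by (rule binary_quadratic_two_zeros[OF T(1,2) c13])
  obtain l where l: "t 2 * (w 2 + \<delta> * t 2) = l * (w 1 * w 3)"
    "(t 2)^2 + \<sigma> * (t 2 * w 2) + (w 2)^2 = - l * (t 1 * w 3 + t 3 * w 1)"
    "w 2 * (t 2 + \<epsilon> * w 2) = l * (t 1 * t 3)"
    by (rule binary_quadratic_two_zeros[OF T(3,4) c13])
  \<comment> \<open>Otherwise \<open>A\<close>, \<open>B\<close>, \<open>C\<close> all vanish at
    vertex 0, and independence kills all its quadratic monomials.\<close>
  have "k \<noteq> 0"
  proof
    assume "k = 0"
    with k have "(t 0)^2 = 0 \<and> t 0 * w 0 = 0 \<and> (w 0)^2 = 0"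
      by (intro indep) (auto simp: algebra_simps power2_eq_square)
    with tw(1)[of 0] show False by simp
  qed
  \<comment> \<open>Both coefficient triples are multiples of the same vector, so this combination
    of the two Veronese vectors lies in the kernel. Hence the vectors are parallel, and vertices 0
    and 2 coincide.\<close>
  have "l * (t 0)^2 - k * (t 2)^2 = 0 \<and> l * (t 0 * w 0) - k * (t 2 * w 2) = 0 \<and>
      l * (w 0)^2 - k * (w 2)^2 = 0"
    by (rule indep) (use k l in algebra)+
  then have "k * (t 0 * w 2 - t 2 * w 0)^2 = 0"
    by algebra
  with \<open>k \<noteq> 0\<close> cross[of 0 2] show False by simp
qed

section \<open>Centre at the focus: explicit quadrilaterals\<close>

text \<open>\<open>t\<close> is a root of T^2 - x T + 1, whose discriminant is positive. The roots
  have product 1, so t^2 = 1 would make the root double.\<close>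

lemma exists_reciprocal_sum:
  fixes x :: real
  assumes "x^2 > 4"
  obtains t :: real where "t \<noteq> 0" "t^2 \<noteq> 1" "t + 1 / t = x"
proof -
  define t where "t = (x + sqrt (x^2 - 4)) / 2"
  have "sqrt (x^2 - 4) ^ 2 = x^2 - 4" using assms by simp
  then have eq: "t^2 + 1 = x * t"
    unfolding t_def by (simp add: power2_eq_square field_simps)
  then have "t \<noteq> 0" by auto
  moreover have "t^2 \<noteq> 1"
  proof
    assume "t^2 = 1"
    with eq have "x * t = 2" by simp
    with \<open>t^2 = 1\<close> have "x^2 = 4" by algebra
    with assms show False by simp
  qed
  moreover have "t + 1 / t = x"
    using eq \<open>t \<noteq> 0\<close> by (simp add: field_simps power2_eq_square)
  ultimately show thesis by (rule that)
qed

text \<open>For parameters (a : 1) and (b : 1) the tangency form is a b (a + 1/a + b + 1/b + 2 p).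
  The bracket is invariant under inverting \<open>a\<close> or \<open>b\<close>, so one equation
  makes all four sides tangent.\<close>

lemma poncelet_pair_4_centred:
  assumes p: "p \<noteq> 0"
  shows "poncelet_pair 4 (unit_circle 0) (parabola p)"
proof -
  \<comment> \<open>Two numbers with sum $-2p$ and of modulus greater than 2, so that \<open>t\<close> and \<open>s\<close> are real
    and different from $\pm 1$.\<close>
  define x y where "x = - p + (\<bar>p\<bar> + 3)" "y = - p - (\<bar>p\<bar> + 3)"
  have xy: "x \<ge> 3" "y \<le> -3" "x + y = - 2 * p" by (auto simp: x_y_def)
  have "x^2 \<ge> 3^2" "y^2 \<ge> 3^2"
    using xy power_mono[of 3 x 2] power_mono[of 3 "- y" 2] by auto
  then have "x^2 > 4" "y^2 > 4" by auto
  obtain t where t: "t \<noteq> 0" "t^2 \<noteq> 1" "t + 1 / t = x"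
    by (rule exists_reciprocal_sum[OF \<open>x^2 > 4\<close>])
  obtain s where s: "s \<noteq> 0" "s^2 \<noteq> 1" "s + 1 / s = y"
    by (rule exists_reciprocal_sum[OF \<open>y^2 > 4\<close>])
  define z where "z i = (if i = 0 then t else if i = 1 then s else if i = 2 then 1 / t else 1 / s)"
    for i :: nat
  have z: "z 0 = t" "z 1 = s" "z (Suc 0) = s" "z (Suc (Suc 0)) = 1 / t" "z 2 = 1 / t" "z 3 = 1 / s"
    by (auto simp: z_def)
  have below_4: "i < 4 \<longleftrightarrow> i = 0 \<or> i = 1 \<or> i = 2 \<or> i = 3" for i :: nat
    by auto
  have next_4: "Suc i mod 4 = (if i = 3 then 0 else Suc i)" if "i < 4" for i :: nat
    using that by auto
  \<comment> \<open>Any of these equalities would give equal reciprocal sums, but \<open>x\<close>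
    and \<open>y\<close> have opposite signs.\<close>
  have "t \<noteq> s" "t \<noteq> 1 / s" "s \<noteq> 1 / t"
    using t(3) s(3) xy by auto
  moreover have "t \<noteq> 1 / t" "s \<noteq> 1 / s"
    using t s by (auto simp: field_simps power2_eq_square)
  ultimately have z_inj: "z i = z j \<longleftrightarrow> i = j" if "i < 4" "j < 4" for i j
    using that t(1) s(1) unfolding below_4 by (auto simp: z field_simps)
  have z_sum: "z i \<noteq> 0 \<and> z j \<noteq> 0 \<and> z i + 1 / z i + (z j + 1 / z j) = - 2 * p"
    if "i < 4" "j = Suc i mod 4" for i j
    using that t s xy unfolding below_4 by (auto simp: z)
  define V where "V i = circle_point 0 (of_real (z i)) 1" for i
  define c where "c i = chord 0 (of_real (z i)) 1 (of_real (z (Suc i mod 4))) 1" for i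
  define S where "S i = {P. on_line (c i) P}" for i
  have c: "c i \<noteq> 0" if "i < 4" for i
    unfolding c_def by (rule chord_nonzero) (use that z_inj[of i "Suc i mod 4"] in \<open>auto simp: next_4\<close>)
  \<comment> \<open>Each side contains exactly two of the four vertices, so equal sides have the
    same pair of consecutive indices; this yields the injectivity of \<open>S\<close>.\<close>
  have V_mem: "V j \<in> S i \<longleftrightarrow> j = i \<or> j = Suc i mod 4" if "i < 4" "j < 4" for i j
    using that z_inj[of j i] z_inj[of j "Suc i mod 4"]
    by (simp add: V_def S_def c_def on_line_chord flip: of_real_diff)
  have "inj_on V {..<4}"
    by (rule inj_onI) (simp add: V_def circle_point_eq_iff z_inj)
  moreover have "inj_on S {..<4}"
  proof (rule inj_onI)
    fix i j :: nat assume ij: "i \<in> {..<4}" "j \<in> {..<4}" "S i = S j"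
    then have "V i \<in> S j" "V (Suc i mod 4) \<in> S j"
      using V_mem[of i i] V_mem[of i "Suc i mod 4"] by auto
    then have "i = j \<or> i = Suc j mod 4" "Suc i mod 4 = j \<or> Suc i mod 4 = Suc j mod 4"
      using ij V_mem[of j i] V_mem[of j "Suc i mod 4"] by auto
    with ij show "i = j" by (auto simp: next_4 split: if_splits)
  qed
  moreover have "V i \<in> conic_points (unit_circle 0)" for i
    unfolding V_def by (rule circle_point_in_unit_circle) simp
  moreover have "tangent_to (S i) (parabola p)" if "i < 4" for i
  proof -
    define a b where "a = z i" "b = z (Suc i mod 4)"
    have ab: "a \<noteq> 0" "b \<noteq> 0" "a + 1 / a + (b + 1 / b) = - 2 * p"
      using z_sum[OF that refl] by (auto simp: a_b_def)
    have "a * b^2 + (a^2 + 2 * p * a + 1) * b + a = a * b * (a + 1 / a + (b + 1 / b) + 2 * p)"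
      using ab(1,2) by (simp add: field_simps power2_eq_square)
    also have "\<dots> = 0" using ab(3) by simp
    finally have eq: "a * b^2 + (a^2 + 2 * p * a + 1) * b + a = 0" .
    have "tangency 0 p (of_real a) 1 (of_real b) 1
        = of_real (a * b^2 + (a^2 + 2 * p * a + 1) * b + a)"
      by (simp add: tangency_def flip: zero_complex.code)
    then have "tangency 0 p (of_real a) 1 (of_real b) 1 = 0"
      by (simp only: eq of_real_0)
    with tangency_chord[of p 0 "of_real a" 1 "of_real b" 1] c[OF that] show ?thesis
      unfolding tangent_to_parabola_iff[OF p]
      by (intro exI[of _ "c i"]) (simp add: S_def c_def a_b_def)
  qed
  moreover have "is_line (S i) \<and> V i \<in> S i \<and> V (Suc i mod 4) \<in> S i" if "i < 4" for i
    using that c V_mem by (auto simp: is_line_def S_def)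
  ultimately have "poncelet_polygon 4 (unit_circle 0) (parabola p) V S"
    by (simp add: poncelet_polygon_def is_polygon_def)
  then show ?thesis
    using p by (auto simp: poncelet_pair_def smooth_conic_parabola smooth_conic_unit_circle)
qed

theorem theorem3p5:
  fixes E :: "real^2"
  shows "isoperiodic 4 {parabola p | p. p \<noteq> 0} (unit_circle E) \<longleftrightarrow> E = 0"
proof
  assume iso: "isoperiodic 4 {parabola p | p. p \<noteq> 0} (unit_circle E)"
  show "E = 0"
  proof (rule ccontr)
    assume E: "E \<noteq> 0"
    then have "(E $ 1)^2 + (E $ 2)^2 \<noteq> 0"
      by (auto simp: vec_eq_iff forall_2 sum_power2_eq_zero_iff)
    \<comment> \<open>The determinant is affine in \<open>p\<close> with nonzero slope, so it cannot
      vanish at both \<open>p\<close> = 1 and \<open>p\<close> = 2.\<close>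
    then have "((E $ 1)^2 + (E $ 2)^2) * (E $ 1 + 1) \<noteq> ((E $ 1)^2 + (E $ 2)^2) * (E $ 1 + 2)"
      by simp
    then obtain p :: real where "p \<noteq> 0" "((E $ 1)^2 + (E $ 2)^2) * (E $ 1 + p) \<noteq> E $ 1"
      by (metis one_neq_zero zero_neq_numeral)
    with E not_poncelet_pair_4 iso show False
      by (auto simp: isoperiodic_def)
  qed
next
  assume "E = 0"
  then show "isoperiodic 4 {parabola p | p. p \<noteq> 0} (unit_circle E)"
    by (auto simp: isoperiodic_def smooth_conic_parabola smooth_conic_unit_circle
        poncelet_pair_4_centred)
qed

end
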